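(* Let $U\in\mathbb{R}^{m\times n}$ and $Q\in\mathbb{S}^{n}$. There exists $X\in\mathbb{R}^{m\times n}$ satisfying $$Q+U^\top X + X^\top U\succcurlyeq 0$$ if and only if $$U_{\perp}^\top QU_{\perp}\succcurlyeq 0.$$ If, in addition to $U_{\perp}^\top QU_{\perp}\succcurlyeq 0$, it holds that $$\ker U\cap \{\xi\in\mathbb{R}^{n}\mid \xi^\top Q\xi=0\}\subset\ker Q,$$ then there exists $\alpha>0$ such that $Q+U^\top X + X^\top U\succcurlyeq 0$ holds with $X=\alpha U$.
   Context: $\mathbb{S}^n$ denotes the set of real symmetric $n\times n$ matrices. For symmetric $S$, $S\succcurlyeq 0$ means that $S$ is positive semi-definite. For a matrix $A\in\mathbb{R}^{m\times n}$, $\ker A=\{x\in\mathbb{R}^{n}\mid Ax=0\}$, and the annihilator $A_\perp$ denotes any matrix whose columns form a basis of $\ker A$ (a matrix with no columns if $\ker A=\{0\}$, in which case $A_\perp^\top QA_\perp\succcurlyeq 0$ holds vacuously); $A_\perp^\top$ is its transpose. The symbol $\subset$ denotes (not necessarily proper) set inclusion. *)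

theory Defs
  imports Complex_Main "Jordan_Normal_Form.Matrix_Kernel"
begin

definition sym_mat :: "nat \<Rightarrow> real mat set" where
  "sym_mat n = {S \<in> carrier_mat n n. transpose_mat S = S}"

(* A 0 x 0 matrix is positive semi-definite: the only vector to test is the empty one. *)
definition psd :: "real mat \<Rightarrow> bool" where
  "psd S \<longleftrightarrow> S \<in> sym_mat (dim_row S) \<and>
     (\<forall>x \<in> carrier_vec (dim_row S). 0 \<le> x \<bullet> (S *\<^sub>v x))"

(* The distinctness of the columns is needed because the basis predicate speaks about
   a set of vectors, which does not see repeated columns.
   If the kernel of A is trivial, then N has no columns. *)
definition annihilator :: "real mat \<Rightarrow> real mat \<Rightarrow> bool" where
  "annihilator A N \<longleftrightarrow> dim_row N = dim_col A \<and> distinct (cols N) \<and>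
     kernel.basis (dim_col A) A (set (cols N))"

lemma annihilator_exists: "\<exists>N. annihilator A N"
proof -
  have A: "A \<in> carrier_mat (dim_row A) (dim_col A)" by simp
  interpret kernel "dim_row A" "dim_col A" A by (unfold_locales) (rule A)
  obtain B where B: "finite B" "basis B"
    using kernel_basis_exists[OF A] by blast
  obtain bs where bs: "set bs = B" "distinct bs"
    using finite_distinct_list[OF B(1)] by blast
  have "B \<subseteq> carrier_vec (dim_col A)"
    using B(2) mat_kernel_carrier[OF A] by (auto simp: Ker.basis_def)
  then have "cols (mat_of_cols (dim_col A) bs) = bs"
    using bs(1) by simp
  then have "annihilator A (mat_of_cols (dim_col A) bs)"
    using B(2) bs by (simp add: annihilator_def)
  then show ?thesis ..
qed

end

theory Submission
  imports Defs
begin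

text \<open>
  Tested on a vector \<open>x\<close>, the inequality \<open>Q + U\<^sup>T X + X\<^sup>T U \<succeq> 0\<close> reads
  \<open>x \<bullet> Q x + 2 (U x \<bullet> X x) \<ge> 0\<close> (\<open>psd_add_cross_terms_iff\<close>), and \<open>N\<^sup>T Q N \<succeq> 0\<close> says that the
  form of \<open>Q\<close> is nonnegative on \<open>ker U\<close>, because the range of an annihilator \<open>N\<close> is that kernel
  (\<open>psd_annihilator_iff\<close>). On \<open>ker U\<close> the cross term vanishes, so the second condition is
  necessary for the first.

  The converse uses a generalized inverse \<open>G\<close>, that is \<open>U G U = U\<close>: every \<open>x\<close> splits into
  \<open>y = G U x\<close>, which depends on \<open>U x\<close> only, and \<open>x - y\<close>, which lies in \<open>ker U\<close>. One can choose
  \<open>X\<close> such that \<open>2 (U x \<bullet> X x)\<close> cancels everything in \<open>x \<bullet> Q x\<close> that involves \<open>y\<close>; what remains is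
  the form of \<open>Q\<close> at \<open>x - y\<close> (\<open>exists_multiplier_if_nonneg_on_kernel\<close>).

  For \<open>X = \<alpha> U\<close> the cross term is the penalty \<open>2 \<alpha> (U x \<bullet> U x)\<close>, as in Finsler's lemma. The obstacle
  is the mixed term \<open>y \<bullet> Q (x - y)\<close>, which is linear in \<open>x - y\<close> and could dominate where the form of
  \<open>Q\<close> on \<open>ker U\<close> degenerates. The assumption that isotropic vectors of \<open>ker U\<close> lie in \<open>ker Q\<close>
  makes the mixed term vanish in the degenerate directions. It can then be absorbed by completing
  the square, at the cost of a quadratic form in \<open>U x\<close>, which the penalty dominates for large
  \<open>\<alpha>\<close> (\<open>exists_penalty_if_isotropic_kernel_vectors_null\<close>). A second generalized inverse, of the
  compressed form, carries out the completion algebraically, without a compactness argument.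
\<close>

section \<open>Generalized inverses\<close>

definition outer_prod :: "'a :: semiring_0 vec \<Rightarrow> 'a vec \<Rightarrow> 'a mat" where
  "outer_prod v w = mat (dim_vec v) (dim_vec w) (\<lambda>(i, j). v $ i * w $ j)"

lemma outer_prod_carrier [simp]:
  "v \<in> carrier_vec n \<Longrightarrow> w \<in> carrier_vec m \<Longrightarrow> outer_prod v w \<in> carrier_mat n m"
  by (simp add: outer_prod_def)

lemma outer_prod_mult_vec:
  fixes v w x :: "'a :: comm_ring_1 vec"
  assumes "w \<in> carrier_vec m" "x \<in> carrier_vec m"
  shows "outer_prod v w *\<^sub>v x = (w \<bullet> x) \<cdot>\<^sub>v v"
  using assms
  by (intro eq_vecI) (auto simp: outer_prod_def scalar_prod_def sum_distrib_left mult_ac)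

text \<open>
  A matrix \<open>G\<close> with \<open>A G A = A\<close> is built by induction on the number of columns on which \<open>A G\<close> is
  already the identity. The image of the next column is corrected by a rank-one update of \<open>G\<close> that
  does not disturb the earlier columns.
\<close>
lemma generalized_inverse_on_columns:
  fixes A :: "'a :: field mat"
  assumes A: "A \<in> carrier_mat m n" and "k \<le> n"
  shows "\<exists>G \<in> carrier_mat n m. \<forall>j<k. A *\<^sub>v (G *\<^sub>v col A j) = col A j"
  using \<open>k \<le> n\<close>
proof (induction k)
  case 0
  show ?case by (rule bexI[of _ "0\<^sub>m n m"]) auto
next
  case (Suc k)
  then obtain G where G: "G \<in> carrier_mat n m"
    and fixed: "\<And>j. j < k \<Longrightarrow> A *\<^sub>v (G *\<^sub>v col A j) = col A j" by auto
  define b where "b = col A k"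
  define r where "r = b - A *\<^sub>v (G *\<^sub>v b)"
  have k: "k < n" using Suc.prems by simp
  have col: "col A j \<in> carrier_vec m" for j using A by (metis carrier_matD(1) col_dim)
  have b: "b \<in> carrier_vec m" unfolding b_def by (rule col)
  have AGb: "A *\<^sub>v (G *\<^sub>v b) \<in> carrier_vec m" using A G b by auto
  have r: "r \<in> carrier_vec m" using b AGb by (auto simp: r_def)
  have r_index: "r $ i = b $ i - (A *\<^sub>v (G *\<^sub>v b)) $ i" if "i < m" for i
    unfolding r_def using carrier_vecD[OF AGb] that by (intro index_minus_vec(1)) simp
  show ?case
  proof (cases "r = 0\<^sub>v m")
    case True
    have "A *\<^sub>v (G *\<^sub>v b) = b"
    proof (rule eq_vecI)
      fix i assume i: "i < dim_vec b"
      then show "(A *\<^sub>v (G *\<^sub>v b)) $ i = b $ i"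
        using r_index True carrier_vecD[OF b] by simp
    qed (use carrier_vecD[OF b] carrier_vecD[OF AGb] in simp)
    then show ?thesis using G fixed b_def by (auto simp: less_Suc_eq intro!: bexI[of _ G])
  next
    case False
    then obtain i where i: "i < m" and ri: "r $ i \<noteq> 0"
      using r by (metis carrier_vecD eq_vecI index_zero_vec(1) index_zero_vec(2))
    define w where "w = row (1\<^sub>m m - A * G) i"
    have AG: "A * G \<in> carrier_mat m m" using A G by auto
    have w: "w \<in> carrier_vec m"
      using AG unfolding w_def by (metis carrier_matD(2) minus_carrier_mat row_carrier)
    have w_prod: "w \<bullet> x = x $ i - (A *\<^sub>v (G *\<^sub>v x)) $ i" if x: "x \<in> carrier_vec m" for x
    proof -
      have "w \<bullet> x = ((1\<^sub>m m - A * G) *\<^sub>v x) $ i"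
        unfolding w_def by (rule index_mult_mat_vec[symmetric]) (use i A in simp)
      also have "(1\<^sub>m m - A * G) *\<^sub>v x = x - A *\<^sub>v (G *\<^sub>v x)"
        using x AG A G by (subst minus_mult_distrib_mat_vec[of _ m m]) auto
      finally show ?thesis using i x A G by simp
    qed
    define d where "d = unit_vec n k - G *\<^sub>v b"
    have d: "d \<in> carrier_vec n" using G b by (auto simp: d_def)
    have Ad: "A *\<^sub>v d = r"
    proof -
      have "A *\<^sub>v unit_vec n k = b"
        using A k by (intro eq_vecI) (auto simp: b_def)
      then show ?thesis
        using A G b by (simp add: d_def r_def mult_minus_distrib_mat_vec[OF A])
    qed
    \<comment> \<open>\<open>w\<close> annihilates the columns already fixed, and \<open>w \<bullet> b = r $ i\<close>; the rank-one
        correction therefore moves only the image of \<open>b\<close>, and moves it by \<open>r\<close>.\<close>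
    define G' where "G' = G + outer_prod d ((1 / r $ i) \<cdot>\<^sub>v w)"
    have G': "G' \<in> carrier_mat n m" using G d w by (auto simp: G'_def)
    have AG': "A *\<^sub>v (G' *\<^sub>v x) = A *\<^sub>v (G *\<^sub>v x) + ((w \<bullet> x) / r $ i) \<cdot>\<^sub>v r"
      if x: "x \<in> carrier_vec m" for x
    proof -
      have "G' *\<^sub>v x = G *\<^sub>v x + ((w \<bullet> x) / r $ i) \<cdot>\<^sub>v d"
        using G d w x unfolding G'_def
        by (subst add_mult_distrib_mat_vec[of _ n m]) (auto simp: outer_prod_mult_vec[of _ m])
      then show ?thesis
        using A G d x Ad by (simp add: mult_add_distrib_mat_vec[OF A] mult_mat_vec[OF A d])
    qed
    have "A *\<^sub>v (G' *\<^sub>v col A j) = col A j" if "j < Suc k" for j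
    proof (cases "j = k")
      case True
      have "w \<bullet> b = r $ i" using w_prod[OF b] r_index[OF i] by simp
      then have "A *\<^sub>v (G' *\<^sub>v b) = A *\<^sub>v (G *\<^sub>v b) + r"
        using AG'[OF b] ri by simp
      also have "\<dots> = b"
        using carrier_vecD[OF b] carrier_vecD[OF r] r_index by (intro eq_vecI) simp_all
      finally show ?thesis using True b_def by simp
    next
      case False
      then have "A *\<^sub>v (G *\<^sub>v col A j) = col A j" using that fixed by simp
      then show ?thesis
        using AG'[OF col, of j] w_prod[OF col, of j] carrier_vecD[OF r] carrier_vecD[OF col, of j]
        by (intro eq_vecI) simp_all
    qed
    then show ?thesis using G' by auto
  qed
qed

lemma exists_generalized_inverse:
  fixes A :: "'a :: field mat"
  assumes A: "A \<in> carrier_mat m n"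
  shows "\<exists>G \<in> carrier_mat n m. \<forall>x \<in> carrier_vec n. A *\<^sub>v (G *\<^sub>v (A *\<^sub>v x)) = A *\<^sub>v x"
proof -
  obtain G where G: "G \<in> carrier_mat n m"
    and cols: "\<And>j. j < n \<Longrightarrow> A *\<^sub>v (G *\<^sub>v col A j) = col A j"
    using generalized_inverse_on_columns[OF A order.refl] by auto
  have "A * (G * A) = A"
  proof (rule mat_col_eqI)
    fix j assume "j < dim_col A"
    then have j: "j < n" using A by simp
    have GA: "G * A \<in> carrier_mat n n" using G A by simp
    have "col (A * (G * A)) j = A *\<^sub>v (G *\<^sub>v col A j)"
      unfolding col_mult2[OF A GA j] col_mult2[OF G A j] ..
    then show "col (A * (G * A)) j = col A j" using cols[OF j] by simp
  qed (use A G in auto)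
  then have "A *\<^sub>v (G *\<^sub>v (A *\<^sub>v x)) = A *\<^sub>v x" if x: "x \<in> carrier_vec n" for x
    using x A G by (metis assoc_mult_mat_vec mult_carrier_mat)
  then show ?thesis using G by auto
qed

section \<open>Quadratic forms\<close>

lemma smult_mat_mult_vec:
  fixes A :: "'a :: comm_ring_1 mat"
  assumes "A \<in> carrier_mat m n" and "x \<in> carrier_vec n"
  shows "(c \<cdot>\<^sub>m A) *\<^sub>v x = c \<cdot>\<^sub>v (A *\<^sub>v x)"
  using assms by (intro eq_vecI) auto

lemma sym_mat_bilinear_commute:
  assumes "Q \<in> sym_mat n" "x \<in> carrier_vec n" "y \<in> carrier_vec n"
  shows "x \<bullet> (Q *\<^sub>v y) = y \<bullet> (Q *\<^sub>v x)"
proof -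
  have "x \<bullet> (Q *\<^sub>v y) = (transpose_mat Q *\<^sub>v x) \<bullet> y"
    using assms by (subst transpose_vec_mult_scalar[of _ n n]) (auto simp: sym_mat_def)
  also have "\<dots> = y \<bullet> (Q *\<^sub>v x)"
    using assms by (subst comm_scalar_prod[of _ n]) (auto simp: sym_mat_def)
  finally show ?thesis .
qed

lemma sym_mat_quadratic_form_add:
  assumes Q: "Q \<in> sym_mat n" and x: "x \<in> carrier_vec n" and y: "y \<in> carrier_vec n"
  shows "(x + y) \<bullet> (Q *\<^sub>v (x + y)) = x \<bullet> (Q *\<^sub>v x) + 2 * (y \<bullet> (Q *\<^sub>v x)) + y \<bullet> (Q *\<^sub>v y)"
proof -
  have Qc: "Q \<in> carrier_mat n n" using Q by (simp add: sym_mat_def)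
  note c = mult_mat_vec_carrier[OF Qc x] mult_mat_vec_carrier[OF Qc y]
  have "(x + y) \<bullet> (Q *\<^sub>v (x + y))
      = (x \<bullet> (Q *\<^sub>v x) + x \<bullet> (Q *\<^sub>v y)) + (y \<bullet> (Q *\<^sub>v x) + y \<bullet> (Q *\<^sub>v y))"
    using x y c
    by (simp add: mult_add_distrib_mat_vec[OF Qc x y] add_scalar_prod_distrib[of _ n]
        scalar_prod_add_distrib[of _ n])
  then show ?thesis using sym_mat_bilinear_commute[OF Q x y] by simp
qed

lemma sym_mat_congruence:
  assumes Q: "Q \<in> sym_mat n" and W: "W \<in> carrier_mat n k"
  shows "transpose_mat W * Q * W \<in> sym_mat k"
proof -
  have Qc: "Q \<in> carrier_mat n n" and Qt: "transpose_mat Q = Q" using Q by (auto simp: sym_mat_def)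
  have WQ: "transpose_mat W * Q \<in> carrier_mat k n" using W Qc by auto
  have "transpose_mat (transpose_mat W * Q * W) = transpose_mat W * transpose_mat (transpose_mat W * Q)"
    by (rule transpose_mult[OF WQ W])
  also have "transpose_mat (transpose_mat W * Q) = Q * W"
    using W Qc Qt by (simp add: transpose_mult[of _ k n _ n])
  also have "transpose_mat W * (Q * W) = transpose_mat W * Q * W"
    using W Qc by (simp add: assoc_mult_mat[of _ k n _ n _ k])
  finally show ?thesis using WQ W by (simp add: sym_mat_def)
qed

lemma bilinear_congruence:
  fixes Q :: "real mat"
  assumes Q: "Q \<in> carrier_mat n n" and W: "W \<in> carrier_mat n k"
    and x: "x \<in> carrier_vec k" and y: "y \<in> carrier_vec k"
  shows "x \<bullet> ((transpose_mat W * Q * W) *\<^sub>v y) = (W *\<^sub>v x) \<bullet> (Q *\<^sub>v (W *\<^sub>v y))"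
proof -
  have QWy: "Q *\<^sub>v (W *\<^sub>v y) \<in> carrier_vec n" using Q W y by auto
  have "(transpose_mat W * Q * W) *\<^sub>v y = transpose_mat W *\<^sub>v (Q *\<^sub>v (W *\<^sub>v y))"
    using Q W y by (simp add: assoc_mult_mat_vec[of _ k n _ k] assoc_mult_mat_vec[of _ k n _ n])
  then have "x \<bullet> ((transpose_mat W * Q * W) *\<^sub>v y)
      = (transpose_mat W *\<^sub>v (Q *\<^sub>v (W *\<^sub>v y))) \<bullet> x"
    using x W QWy by (simp add: comm_scalar_prod[of x k])
  also have "\<dots> = (Q *\<^sub>v (W *\<^sub>v y)) \<bullet> (W *\<^sub>v x)"
    by (rule transpose_vec_mult_scalar[OF W x QWy])
  also have "\<dots> = (W *\<^sub>v x) \<bullet> (Q *\<^sub>v (W *\<^sub>v y))"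
    using W x by (intro comm_scalar_prod[OF QWy]) auto
  finally show ?thesis .
qed

text \<open>
  Each monomial \<open>u\<^sub>i u\<^sub>j\<close> is at most \<open>u \<bullet> u\<close> in absolute value, so the sum of the absolute values of
  the entries of \<open>B\<close> is a bound.
\<close>
lemma quadratic_form_bounded:
  fixes B :: "real mat"
  assumes B: "B \<in> carrier_mat m m"
  shows "\<exists>c>0. \<forall>u \<in> carrier_vec m. u \<bullet> (B *\<^sub>v u) \<le> c * (u \<bullet> u)"
proof -
  \<comment> \<open>The summand \<open>1\<close> makes \<open>c\<close> positive when \<open>B\<close> is zero.\<close>
  define c where "c = (\<Sum>i<m. \<Sum>j<m. \<bar>B $$ (i, j)\<bar>) + 1"
  have "u \<bullet> (B *\<^sub>v u) \<le> c * (u \<bullet> u)" if u: "u \<in> carrier_vec m" for u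
  proof -
    have sq: "(u $ i)\<^sup>2 \<le> u \<bullet> u" if "i < m" for i
      using u that
      by (auto simp: scalar_prod_def power2_eq_square intro!: member_le_sum[of i _ "\<lambda>i. u $ i * u $ i"])
    have "u \<bullet> (B *\<^sub>v u) = (\<Sum>i<m. \<Sum>j<m. B $$ (i, j) * (u $ i * u $ j))"
      using B u by (auto simp: scalar_prod_def sum_distrib_left atLeast0LessThan mult_ac
          intro!: sum.cong)
    also have "\<dots> \<le> (\<Sum>i<m. \<Sum>j<m. \<bar>B $$ (i, j)\<bar> * (u \<bullet> u))"
    proof (intro sum_mono)
      fix i j assume "i \<in> {..<m}" "j \<in> {..<m}"
      then have "(u $ i)\<^sup>2 + (u $ j)\<^sup>2 \<le> 2 * (u \<bullet> u)" using sq[of i] sq[of j] by auto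
      moreover have "2 * \<bar>u $ i * u $ j\<bar> \<le> (u $ i)\<^sup>2 + (u $ j)\<^sup>2"
        using sum_squares_bound[of "\<bar>u $ i\<bar>" "\<bar>u $ j\<bar>"] by (simp add: abs_mult)
      ultimately have "\<bar>u $ i * u $ j\<bar> \<le> u \<bullet> u" by simp
      then have "\<bar>B $$ (i, j)\<bar> * \<bar>u $ i * u $ j\<bar> \<le> \<bar>B $$ (i, j)\<bar> * (u \<bullet> u)"
        by (intro mult_left_mono) auto
      then show "B $$ (i, j) * (u $ i * u $ j) \<le> \<bar>B $$ (i, j)\<bar> * (u \<bullet> u)"
        by (metis abs_ge_self abs_mult order_trans)
    qed
    also have "\<dots> = (c - 1) * (u \<bullet> u)" by (simp add: c_def sum_distrib_right)
    also have "\<dots> \<le> c * (u \<bullet> u)"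
    proof -
      have "0 \<le> u \<bullet> u" by (auto simp: scalar_prod_def intro!: sum_nonneg)
      then show ?thesis by (simp add: algebra_simps)
    qed
    finally show ?thesis .
  qed
  moreover have "c > 0" unfolding c_def by (intro add_nonneg_pos sum_nonneg) auto
  ultimately show ?thesis by auto
qed

section \<open>The two matrix inequalities as conditions on vectors\<close>

lemma psd_add_cross_terms_iff:
  assumes U: "U \<in> carrier_mat m n" and Q: "Q \<in> sym_mat n" and X: "X \<in> carrier_mat m n"
  shows "psd (Q + transpose_mat U * X + transpose_mat X * U)
    \<longleftrightarrow> (\<forall>x \<in> carrier_vec n. 0 \<le> x \<bullet> (Q *\<^sub>v x) + 2 * ((U *\<^sub>v x) \<bullet> (X *\<^sub>v x)))"
proof -
  define S where "S = Q + transpose_mat U * X + transpose_mat X * U"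
  have Qc: "Q \<in> carrier_mat n n" and Qt: "transpose_mat Q = Q" using Q by (auto simp: sym_mat_def)
  have UX: "transpose_mat U * X \<in> carrier_mat n n" and XU: "transpose_mat X * U \<in> carrier_mat n n"
    using U X by auto
  have S: "S \<in> carrier_mat n n" using Qc UX XU by (simp add: S_def)
  have "transpose_mat S = Q + transpose_mat X * U + transpose_mat U * X"
    using Qc Qt UX XU U X
    by (simp add: S_def transpose_add[of _ n n] transpose_mult[of _ n m _ n])
  also have "\<dots> = S"
    unfolding S_def
    by (simp only: assoc_add_mat[OF Qc XU UX] assoc_add_mat[OF Qc UX XU] comm_add_mat[OF XU UX])
  finally have sym: "S \<in> sym_mat n" using S by (simp add: sym_mat_def)
  have "x \<bullet> (S *\<^sub>v x) = x \<bullet> (Q *\<^sub>v x) + 2 * ((U *\<^sub>v x) \<bullet> (X *\<^sub>v x))"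
    if x: "x \<in> carrier_vec n" for x
  proof -
    have Ux: "U *\<^sub>v x \<in> carrier_vec m" and Xx: "X *\<^sub>v x \<in> carrier_vec m" using U X x by auto
    have "S *\<^sub>v x = Q *\<^sub>v x + transpose_mat U *\<^sub>v (X *\<^sub>v x) + transpose_mat X *\<^sub>v (U *\<^sub>v x)"
      unfolding S_def add_mult_distrib_mat_vec[OF add_carrier_mat[OF UX] XU x]
        add_mult_distrib_mat_vec[OF Qc UX x]
      using U X x by (simp add: assoc_mult_mat_vec[of _ n m _ n])
    then have "x \<bullet> (S *\<^sub>v x) = x \<bullet> (Q *\<^sub>v x) + x \<bullet> (transpose_mat U *\<^sub>v (X *\<^sub>v x))
        + x \<bullet> (transpose_mat X *\<^sub>v (U *\<^sub>v x))"
      using Qc U X x by (simp add: scalar_prod_add_distrib[of _ n])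
    also have "x \<bullet> (transpose_mat U *\<^sub>v (X *\<^sub>v x)) = (U *\<^sub>v x) \<bullet> (X *\<^sub>v x)"
      using transpose_vec_mult_scalar[OF U x Xx] U x Xx Ux
      by (metis comm_scalar_prod mult_mat_vec_carrier transpose_carrier_mat)
    also have "x \<bullet> (transpose_mat X *\<^sub>v (U *\<^sub>v x)) = (U *\<^sub>v x) \<bullet> (X *\<^sub>v x)"
      using transpose_vec_mult_scalar[OF X x Ux] X x Xx Ux
      by (metis comm_scalar_prod mult_mat_vec_carrier transpose_carrier_mat)
    finally show ?thesis by simp
  qed
  then show ?thesis using S sym unfolding S_def[symmetric] psd_def by auto
qed

lemma mat_kernel_eq_range_annihilator:
  assumes N: "annihilator A N"
  shows "mat_kernel A = {N *\<^sub>v v | v. v \<in> carrier_vec (dim_col N)}"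
proof -
  interpret kernel "dim_row A" "dim_col A" A by unfold_locales simp
  have Nc: "N \<in> carrier_mat (dim_col A) (dim_col N)"
    using N by (auto simp: annihilator_def)
  have "basis (set (cols N))" using N by (simp add: annihilator_def)
  then have "set (cols N) \<subseteq> mat_kernel A" and "span (set (cols N)) = mat_kernel A"
    by (auto simp: Ker.basis_def)
  then have "mat_kernel A = NC.col_space N"
    using span_same by (simp add: NC.col_space_def)
  also have "\<dots> = {y \<in> carrier_vec (dim_row N). \<exists>v \<in> carrier_vec (dim_col N). N *\<^sub>v v = y}"
    by (rule NC.col_space_eq[OF Nc])
  also have "\<dots> = {N *\<^sub>v v | v. v \<in> carrier_vec (dim_col N)}"
    using mult_mat_vec_carrier[of N "dim_row N" "dim_col N"] by blast
  finally show ?thesis .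
qed

lemma psd_annihilator_iff:
  assumes U: "U \<in> carrier_mat m n" and Q: "Q \<in> sym_mat n" and N: "annihilator U N"
  shows "psd (transpose_mat N * Q * N) \<longleftrightarrow> (\<forall>z \<in> mat_kernel U. 0 \<le> z \<bullet> (Q *\<^sub>v z))"
proof -
  have Nc: "N \<in> carrier_mat n (dim_col N)" using N U by (auto simp: annihilator_def)
  have Qc: "Q \<in> carrier_mat n n" using Q by (simp add: sym_mat_def)
  show ?thesis
    using sym_mat_congruence[OF Q Nc] bilinear_congruence[OF Qc Nc]
    by (auto simp: psd_def mat_kernel_eq_range_annihilator[OF N])
qed

section \<open>Solving the matrix inequality\<close>

text \<open>
  With \<open>y = G U x\<close> and \<open>X = G\<^sup>T Z\<close>, the cross term \<open>U x \<bullet> X x\<close> becomes \<open>y \<bullet> Z x\<close>. Expanding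
  \<open>(x - y) \<bullet> Q (x - y) = x \<bullet> Q x - 2 (y \<bullet> Q x) + y \<bullet> Q y\<close> shows which \<open>Z\<close> is needed: twice the cross
  term has to be the last two summands, so \<open>Z x = Q y / 2 - Q x\<close>.
\<close>
lemma exists_multiplier_if_nonneg_on_kernel:
  assumes U: "U \<in> carrier_mat m n" and Q: "Q \<in> sym_mat n"
    and nonneg: "\<And>z. z \<in> mat_kernel U \<Longrightarrow> 0 \<le> z \<bullet> (Q *\<^sub>v z)"
  shows "\<exists>X \<in> carrier_mat m n.
    \<forall>x \<in> carrier_vec n. 0 \<le> x \<bullet> (Q *\<^sub>v x) + 2 * ((U *\<^sub>v x) \<bullet> (X *\<^sub>v x))"
proof -
  have Qc: "Q \<in> carrier_mat n n" using Q by (simp add: sym_mat_def)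
  obtain G where G: "G \<in> carrier_mat n m"
    and UGU: "\<And>x. x \<in> carrier_vec n \<Longrightarrow> U *\<^sub>v (G *\<^sub>v (U *\<^sub>v x)) = U *\<^sub>v x"
    using exists_generalized_inverse[OF U] by auto
  define Z where "Z = (1/2) \<cdot>\<^sub>m (Q * (G * U)) - Q"
  define X where "X = transpose_mat G * Z"
  have Z: "Z \<in> carrier_mat n n" using Qc G U by (auto simp: Z_def)
  have X: "X \<in> carrier_mat m n" using G Z by (simp add: X_def)
  have "0 \<le> x \<bullet> (Q *\<^sub>v x) + 2 * ((U *\<^sub>v x) \<bullet> (X *\<^sub>v x))" if x: "x \<in> carrier_vec n" for x
  proof -
    define y where "y = G *\<^sub>v (U *\<^sub>v x)"
    have y: "y \<in> carrier_vec n" using G U x by (auto simp: y_def)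
    have Ux: "U *\<^sub>v x \<in> carrier_vec m" using U x by auto
    have Zx: "Z *\<^sub>v x = (1/2) \<cdot>\<^sub>v (Q *\<^sub>v y) - Q *\<^sub>v x"
    proof -
      have GU: "G * U \<in> carrier_mat n n" using G U by simp
      have QGU: "Q * (G * U) \<in> carrier_mat n n" using Qc GU by simp
      have "Q * (G * U) *\<^sub>v x = Q *\<^sub>v y"
        by (simp add: assoc_mult_mat_vec[OF Qc GU x] assoc_mult_mat_vec[OF G U x] y_def)
      then show ?thesis
        unfolding Z_def minus_mult_distrib_mat_vec[OF smult_carrier_mat[OF QGU] Qc x]
        by (simp add: smult_mat_mult_vec[OF QGU x])
    qed
    have Zxc: "Z *\<^sub>v x \<in> carrier_vec n" using Z x by auto
    have "(U *\<^sub>v x) \<bullet> (X *\<^sub>v x) = (U *\<^sub>v x) \<bullet> (transpose_mat G *\<^sub>v (Z *\<^sub>v x))"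
      using G Z x by (simp add: X_def assoc_mult_mat_vec[of _ m n _ n])
    also have "\<dots> = y \<bullet> (Z *\<^sub>v x)"
      using transpose_vec_mult_scalar[OF G Ux Zxc] G Ux Zxc y unfolding y_def
      by (metis comm_scalar_prod mult_mat_vec_carrier transpose_carrier_mat)
    also have "\<dots> = (1/2) * (y \<bullet> (Q *\<^sub>v y)) - y \<bullet> (Q *\<^sub>v x)"
      using Qc x y by (simp add: Zx scalar_prod_minus_distrib[of _ n])
    finally have cross: "2 * ((U *\<^sub>v x) \<bullet> (X *\<^sub>v x)) = y \<bullet> (Q *\<^sub>v y) - 2 * (y \<bullet> (Q *\<^sub>v x))"
      by simp
    have "U *\<^sub>v (x - y) = 0\<^sub>v m"
      unfolding mult_minus_distrib_mat_vec[OF U x y] unfolding y_def UGU[OF x] using Ux by simp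
    then have "0 \<le> (x - y) \<bullet> (Q *\<^sub>v (x - y))"
      using x y by (intro nonneg mat_kernelI[OF U]) auto
    moreover have "x \<bullet> (Q *\<^sub>v x)
        = (x - y) \<bullet> (Q *\<^sub>v (x - y)) + 2 * (y \<bullet> (Q *\<^sub>v (x - y))) + y \<bullet> (Q *\<^sub>v y)"
    proof -
      have "x = (x - y) + y" using x y by (intro eq_vecI) auto
      then show ?thesis using sym_mat_quadratic_form_add[OF Q, of "x - y" y] x y by auto
    qed
    moreover have "y \<bullet> (Q *\<^sub>v (x - y)) = y \<bullet> (Q *\<^sub>v x) - y \<bullet> (Q *\<^sub>v y)"
      using Qc x y by (simp add: mult_minus_distrib_mat_vec[of _ n n] scalar_prod_minus_distrib[of _ n])
    ultimately show ?thesis using cross by simp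
  qed
  then show ?thesis using X by auto
qed

text \<open>
  Let \<open>W = 1 - G U\<close>, which maps into \<open>ker U\<close>, and let \<open>M = W\<^sup>T Q W\<close> be the compressed form. A
  vector \<open>v\<close> with \<open>M v = 0\<close> makes \<open>W v\<close> isotropic, hence \<open>Q W v = 0\<close> by assumption. So \<open>ker M\<close> is
  contained in \<open>ker (Q W)\<close>, and \<open>Q W\<close> factors as \<open>T M\<close>. With \<open>y = G U x\<close> and \<open>s = T\<^sup>T y\<close> this
  turns the mixed term \<open>y \<bullet> Q W x\<close> into \<open>s \<bullet> M x\<close>, and completing the square gives
  \<open>x \<bullet> Q x = (x + s) \<bullet> M (x + s) - s \<bullet> M s + y \<bullet> Q y\<close>. The first summand is nonnegative; the
  others form a quadratic form in \<open>U x\<close>, since \<open>s\<close> and \<open>y\<close> are linear in \<open>U x\<close>.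
\<close>
lemma exists_penalty_if_isotropic_kernel_vectors_null:
  assumes U: "U \<in> carrier_mat m n" and Q: "Q \<in> sym_mat n"
    and nonneg: "\<And>z. z \<in> mat_kernel U \<Longrightarrow> 0 \<le> z \<bullet> (Q *\<^sub>v z)"
    and null: "\<And>z. z \<in> mat_kernel U \<Longrightarrow> z \<bullet> (Q *\<^sub>v z) = 0 \<Longrightarrow> Q *\<^sub>v z = 0\<^sub>v n"
  shows "\<exists>c>0. \<forall>x \<in> carrier_vec n. 0 \<le> x \<bullet> (Q *\<^sub>v x) + c * ((U *\<^sub>v x) \<bullet> (U *\<^sub>v x))"
proof -
  have Qc: "Q \<in> carrier_mat n n" using Q by (simp add: sym_mat_def)
  obtain G where G: "G \<in> carrier_mat n m"
    and UGU: "\<And>x. x \<in> carrier_vec n \<Longrightarrow> U *\<^sub>v (G *\<^sub>v (U *\<^sub>v x)) = U *\<^sub>v x"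
    using exists_generalized_inverse[OF U] by auto
  define W where "W = 1\<^sub>m n - G * U"
  have W: "W \<in> carrier_mat n n" using G U by (auto simp: W_def)
  have Wx: "W *\<^sub>v x = x - G *\<^sub>v (U *\<^sub>v x)" if "x \<in> carrier_vec n" for x
    using that G U by (simp add: W_def minus_mult_distrib_mat_vec[of _ n n]
        assoc_mult_mat_vec[of _ n m _ n])
  have Wker: "W *\<^sub>v x \<in> mat_kernel U" if x: "x \<in> carrier_vec n" for x
  proof (rule mat_kernelI[OF U])
    show "W *\<^sub>v x \<in> carrier_vec n" using W x by auto
    show "U *\<^sub>v (W *\<^sub>v x) = 0\<^sub>v m"
      using U G x UGU[OF x] by (simp add: Wx[OF x] mult_minus_distrib_mat_vec[of _ m n])
  qed
  define M where "M = transpose_mat W * Q * W"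
  have Msym: "M \<in> sym_mat n" unfolding M_def by (rule sym_mat_congruence[OF Q W])
  then have M: "M \<in> carrier_mat n n" by (simp add: sym_mat_def)
  have Mform: "x \<bullet> (M *\<^sub>v x) = (W *\<^sub>v x) \<bullet> (Q *\<^sub>v (W *\<^sub>v x))" if "x \<in> carrier_vec n" for x
    unfolding M_def by (rule bilinear_congruence[OF Qc W that that])
  obtain H where H: "H \<in> carrier_mat n n"
    and MHM: "\<And>x. x \<in> carrier_vec n \<Longrightarrow> M *\<^sub>v (H *\<^sub>v (M *\<^sub>v x)) = M *\<^sub>v x"
    using exists_generalized_inverse[OF M] by auto
  define T where "T = Q * W * H"
  have T: "T \<in> carrier_mat n n" using Qc W H by (simp add: T_def)
  have factor: "Q *\<^sub>v (W *\<^sub>v x) = T *\<^sub>v (M *\<^sub>v x)" if x: "x \<in> carrier_vec n" for x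
  proof -
    \<comment> \<open>\<open>H M x\<close> differs from \<open>x\<close> by a vector of \<open>ker M\<close>, on which \<open>Q W\<close> vanishes.\<close>
    define h where "h = H *\<^sub>v (M *\<^sub>v x)"
    have h: "h \<in> carrier_vec n" using H M x by (auto simp: h_def)
    define v where "v = x - h"
    have v: "v \<in> carrier_vec n" using x h by (simp add: v_def)
    have "M *\<^sub>v v = 0\<^sub>v n"
      using M x MHM[OF x] by (simp add: v_def mult_minus_distrib_mat_vec[OF M x h]) (simp add: h_def)
    then have "(W *\<^sub>v v) \<bullet> (Q *\<^sub>v (W *\<^sub>v v)) = 0" using Mform[OF v] v by simp
    then have zero: "Q *\<^sub>v (W *\<^sub>v v) = 0\<^sub>v n" by (rule null[OF Wker[OF v]])
    have "x = v + h" using x h by (intro eq_vecI) (auto simp: v_def)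
    then have "Q *\<^sub>v (W *\<^sub>v x) = Q *\<^sub>v (W *\<^sub>v v) + Q *\<^sub>v (W *\<^sub>v h)"
      using Qc W v h by (simp add: mult_add_distrib_mat_vec[of _ n n])
    also have "\<dots> = Q *\<^sub>v (W *\<^sub>v h)" using zero Qc W h by simp
    also have "\<dots> = T *\<^sub>v (M *\<^sub>v x)"
      using Qc W H M x unfolding T_def h_def by (simp add: assoc_mult_mat_vec[of _ n n _ n])
    finally show ?thesis .
  qed
  define R where "R = transpose_mat T * G"
  have R: "R \<in> carrier_mat n m" using T G by (simp add: R_def)
  \<comment> \<open>With \<open>u = U x\<close>, the form of \<open>B\<close> at \<open>u\<close> is the negative of the remainder
      \<open>y \<bullet> Q y - s \<bullet> M s\<close>, as \<open>s = R u\<close> and \<open>y = G u\<close>.\<close>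
  define B where "B = transpose_mat R * M * R - transpose_mat G * Q * G"
  have RMR: "transpose_mat R * M * R \<in> carrier_mat m m"
    and GQG: "transpose_mat G * Q * G \<in> carrier_mat m m" using R M G Qc by auto
  have B: "B \<in> carrier_mat m m" unfolding B_def by (rule minus_carrier_mat[OF GQG])
  obtain c where c: "c > 0" and bound: "\<And>u. u \<in> carrier_vec m \<Longrightarrow> u \<bullet> (B *\<^sub>v u) \<le> c * (u \<bullet> u)"
    using quadratic_form_bounded[OF B] by auto
  have "0 \<le> x \<bullet> (Q *\<^sub>v x) + c * ((U *\<^sub>v x) \<bullet> (U *\<^sub>v x))" if x: "x \<in> carrier_vec n" for x
  proof -
    define u where "u = U *\<^sub>v x"
    define y where "y = G *\<^sub>v u"
    define z where "z = W *\<^sub>v x"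
    define s where "s = R *\<^sub>v u"
    have u: "u \<in> carrier_vec m" using U x by (auto simp: u_def)
    have y: "y \<in> carrier_vec n" using G u by (auto simp: y_def)
    have z: "z \<in> carrier_vec n" using W x by (auto simp: z_def)
    have s: "s \<in> carrier_vec n" using R u by (auto simp: s_def)
    have Mx: "M *\<^sub>v x \<in> carrier_vec n" using M x by auto
    have "x = z + y"
      using x y carrier_vecD[OF y] by (intro eq_vecI) (simp_all add: z_def Wx[OF x] flip: y_def u_def)
    then have "x \<bullet> (Q *\<^sub>v x) = z \<bullet> (Q *\<^sub>v z) + 2 * (y \<bullet> (Q *\<^sub>v z)) + y \<bullet> (Q *\<^sub>v y)"
      using sym_mat_quadratic_form_add[OF Q z y] by simp
    also have "z \<bullet> (Q *\<^sub>v z) = x \<bullet> (M *\<^sub>v x)" using Mform[OF x] by (simp add: z_def)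
    also have "y \<bullet> (Q *\<^sub>v z) = s \<bullet> (M *\<^sub>v x)"
    proof -
      have "s = transpose_mat T *\<^sub>v y"
        using T G u by (simp add: s_def R_def y_def assoc_mult_mat_vec[of _ n n _ m])
      then show ?thesis
        using transpose_vec_mult_scalar[OF T Mx y] factor[OF x] by (simp add: z_def)
    qed
    finally have q: "x \<bullet> (Q *\<^sub>v x)
        = (x + s) \<bullet> (M *\<^sub>v (x + s)) - (s \<bullet> (M *\<^sub>v s) - y \<bullet> (Q *\<^sub>v y))"
      using sym_mat_quadratic_form_add[OF Msym x s] by simp
    have "u \<bullet> (B *\<^sub>v u) = s \<bullet> (M *\<^sub>v s) - y \<bullet> (Q *\<^sub>v y)"
    proof -
      have "B *\<^sub>v u = (transpose_mat R * M * R) *\<^sub>v u - (transpose_mat G * Q * G) *\<^sub>v u"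
        unfolding B_def by (rule minus_mult_distrib_mat_vec[OF RMR GQG u])
      then have "u \<bullet> (B *\<^sub>v u)
          = u \<bullet> ((transpose_mat R * M * R) *\<^sub>v u) - u \<bullet> ((transpose_mat G * Q * G) *\<^sub>v u)"
        using scalar_prod_minus_distrib[OF u mult_mat_vec_carrier[OF RMR u]
            mult_mat_vec_carrier[OF GQG u]] by simp
      then show ?thesis
        by (simp add: bilinear_congruence[OF M R u u] bilinear_congruence[OF Qc G u u] s_def y_def)
    qed
    then have "s \<bullet> (M *\<^sub>v s) - y \<bullet> (Q *\<^sub>v y) \<le> c * (u \<bullet> u)" using bound[OF u] by simp
    moreover have "0 \<le> (x + s) \<bullet> (M *\<^sub>v (x + s))"
      using Mform[of "x + s"] nonneg[OF Wker[of "x + s"]] x s by simp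
    ultimately show ?thesis using q by (simp add: u_def)
  qed
  then show ?thesis using c by auto
qed

theorem lemma4:
  fixes m n :: nat and U Q N :: "real mat"
  assumes "U \<in> carrier_mat m n"
    and "Q \<in> sym_mat n"
    and "annihilator U N"
  shows "((\<exists>X \<in> carrier_mat m n.
            psd (Q + transpose_mat U * X + transpose_mat X * U))
          \<longleftrightarrow> psd (transpose_mat N * Q * N))
       \<and> (psd (transpose_mat N * Q * N) \<and>
          mat_kernel U \<inter> {\<xi> \<in> carrier_vec n. \<xi> \<bullet> (Q *\<^sub>v \<xi>) = 0} \<subseteq> mat_kernel Q
          \<longrightarrow> (\<exists>\<alpha>::real. \<alpha> > 0 \<and>
                psd (Q + transpose_mat U * (\<alpha> \<cdot>\<^sub>m U) + transpose_mat (\<alpha> \<cdot>\<^sub>m U) * U)))"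
proof -
  note U = assms(1) and Q = assms(2)
  have Qc: "Q \<in> carrier_mat n n" using Q by (simp add: sym_mat_def)
  note psd_N = psd_annihilator_iff[OF assms]
  note psd_X = psd_add_cross_terms_iff[OF U Q]
  have necessary: "psd (transpose_mat N * Q * N)"
    if ex: "\<exists>X \<in> carrier_mat m n. psd (Q + transpose_mat U * X + transpose_mat X * U)"
    unfolding psd_N
  proof
    fix z assume z: "z \<in> mat_kernel U"
    obtain X where X: "X \<in> carrier_mat m n"
      and "psd (Q + transpose_mat U * X + transpose_mat X * U)" using ex by blast
    then have "0 \<le> z \<bullet> (Q *\<^sub>v z) + 2 * ((U *\<^sub>v z) \<bullet> (X *\<^sub>v z))"
      using psd_X[OF X] mat_kernelD(1)[OF U z] by simp
    moreover have "(U *\<^sub>v z) \<bullet> (X *\<^sub>v z) = 0"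
      using mat_kernelD[OF U z] mult_mat_vec_carrier[OF X] by simp
    ultimately show "0 \<le> z \<bullet> (Q *\<^sub>v z)" by simp
  qed
  have sufficient: "\<exists>X \<in> carrier_mat m n. psd (Q + transpose_mat U * X + transpose_mat X * U)"
    if psd: "psd (transpose_mat N * Q * N)"
  proof -
    obtain X where "X \<in> carrier_mat m n"
      and "\<forall>x \<in> carrier_vec n. 0 \<le> x \<bullet> (Q *\<^sub>v x) + 2 * ((U *\<^sub>v x) \<bullet> (X *\<^sub>v x))"
      using exists_multiplier_if_nonneg_on_kernel[OF U Q] psd psd_N by blast
    then show ?thesis using psd_X by blast
  qed
  have penalty: "\<exists>\<alpha>::real. \<alpha> > 0 \<and>
      psd (Q + transpose_mat U * (\<alpha> \<cdot>\<^sub>m U) + transpose_mat (\<alpha> \<cdot>\<^sub>m U) * U)"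
    if *: "psd (transpose_mat N * Q * N) \<and>
      mat_kernel U \<inter> {\<xi> \<in> carrier_vec n. \<xi> \<bullet> (Q *\<^sub>v \<xi>) = 0} \<subseteq> mat_kernel Q"
  proof -
    have nonneg: "0 \<le> z \<bullet> (Q *\<^sub>v z)" if "z \<in> mat_kernel U" for z using * psd_N that by auto
    have null: "Q *\<^sub>v z = 0\<^sub>v n" if "z \<in> mat_kernel U" "z \<bullet> (Q *\<^sub>v z) = 0" for z
    proof -
      have "z \<in> mat_kernel Q" using * that mat_kernelD(1)[OF U that(1)] by auto
      then show ?thesis by (rule mat_kernelD(2)[OF Qc])
    qed
    obtain c where c: "c > 0"
      and form: "\<And>x. x \<in> carrier_vec n \<Longrightarrow> 0 \<le> x \<bullet> (Q *\<^sub>v x) + c * ((U *\<^sub>v x) \<bullet> (U *\<^sub>v x))"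
    proof -
      have "\<exists>c>0. \<forall>x \<in> carrier_vec n. 0 \<le> x \<bullet> (Q *\<^sub>v x) + c * ((U *\<^sub>v x) \<bullet> (U *\<^sub>v x))"
        using U Q nonneg null by (rule exists_penalty_if_isotropic_kernel_vectors_null)
      then show thesis using that by blast
    qed
    \<comment> \<open>Both \<open>U\<^sup>T X\<close> and \<open>X\<^sup>T U\<close> contribute \<open>\<alpha> (U x \<bullet> U x)\<close>, whence
        \<open>\<alpha> = c / 2\<close>.\<close>
    have "2 * ((U *\<^sub>v x) \<bullet> ((c/2) \<cdot>\<^sub>m U *\<^sub>v x)) = c * ((U *\<^sub>v x) \<bullet> (U *\<^sub>v x))"
      if x: "x \<in> carrier_vec n" for x
      by (simp add: smult_mat_mult_vec[OF U x])
    then have "psd (Q + transpose_mat U * ((c/2) \<cdot>\<^sub>m U) + transpose_mat ((c/2) \<cdot>\<^sub>m U) * U)"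
      unfolding psd_X[OF smult_carrier_mat[OF U]] using form by simp
    moreover have "c/2 > 0" using c by simp
    ultimately show ?thesis by blast
  qed
  show ?thesis using necessary sufficient penalty by blast
qed

end
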